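(* Let $k\geq 2$ be an integer and let $\beta>0$. Among all $k$-point subsets of the unit interval $[0,1]$ with the usual distance $d(x,y)=|x-y|$, the Solow--Polasky diversity $D_\beta$ is maximized by the uniformly spaced set $$S_k^\star=\left\{0,\frac{1}{k-1},\frac{2}{k-1},\ldots,1\right\}.$$ The maximum value is $$D_\beta(S_k^\star)=1+(k-1)\tanh\!\left(\frac{\beta}{2(k-1)}\right).$$ Moreover, the maximizing $k$-point subset is unique and is given by $S_k^\star$.
   Context: For $\beta>0$ and a finite subset $S=\{x_1,\ldots,x_k\}$ (with $k$ distinct points) of a metric space $(X,d)$, the exponential similarity matrix is $Z_S=\bigl(e^{-\beta d(x_i,x_j)}\bigr)_{i,j=1}^k$. Whenever $Z_S$ is nonsingular, the Solow--Polasky diversity of $S$ at scale $\beta$ is $D_\beta(S)=\mathbf{1}^\top Z_S^{-1}\mathbf{1}$, where $\mathbf{1}$ is the all-ones column vector in $\mathbb{R}^k$. *)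

theory Defs
  imports Complex_Main "Jordan_Normal_Form.Gauss_Jordan_Elimination"
begin

definition similarity_mat :: "real \<Rightarrow> 'a::metric_space list \<Rightarrow> real mat" where
  "similarity_mat \<beta> xs =
     mat (length xs) (length xs) (\<lambda>(i, j). exp (- \<beta> * dist (xs ! i) (xs ! j)))"

definition all_ones :: "nat \<Rightarrow> real vec" where
  "all_ones n = vec n (\<lambda>_. 1)"

(* Meaningful only when the similarity matrix is nonsingular: otherwise mat_inverse returns
   None, and the inverse is an unspecified matrix. *)

definition diversity_list :: "real \<Rightarrow> 'a::metric_space list \<Rightarrow> real" where
  "diversity_list \<beta> xs =
     all_ones (length xs) \<bullet> (the (mat_inverse (similarity_mat \<beta> xs)) *\<^sub>v all_ones (length xs))"

(* An arbitrary listing without repetitions of a finite set. The lemmas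
   invertible_similarity_mat_cong and solow_polasky_eq_diversity_list below show that
   nonsingularity and the diversity do not depend on this choice. *)

definition enum_set :: "'a set \<Rightarrow> 'a list" where
  "enum_set S = (SOME xs. distinct xs \<and> set xs = S)"

definition solow_polasky :: "real \<Rightarrow> 'a::metric_space set \<Rightarrow> real" where
  "solow_polasky \<beta> S = diversity_list \<beta> (enum_set S)"

definition uniform_points :: "nat \<Rightarrow> real set" where
  "uniform_points k = (\<lambda>i. real i / (real k - 1)) ` {..<k}"

lemma enum_set:
  assumes "finite S"
  shows "distinct (enum_set S)" "set (enum_set S) = S"
proof -
  have "\<exists>xs. distinct xs \<and> set xs = S"
    using finite_distinct_list[OF assms] by blast
  hence "distinct (enum_set S) \<and> set (enum_set S) = S"
    unfolding enum_set_def by (rule someI_ex)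
  thus "distinct (enum_set S)" "set (enum_set S) = S" by auto
qed

lemma distinct_lists_reindex:
  assumes "distinct xs" "distinct ys" "set xs = set ys"
  obtains f where "bij_betw f {0..<length ys} {0..<length xs}"
    and "\<And>i. i < length ys \<Longrightarrow> xs ! f i = ys ! i"
proof -
  have bx: "bij_betw ((!) xs) {0..<length xs} (set xs)"
    using bij_betw_nth[OF assms(1), of "{..<length xs}" "set xs"] by (simp add: atLeast0LessThan)
  have by': "bij_betw ((!) ys) {0..<length ys} (set xs)"
    using bij_betw_nth[OF assms(2), of "{..<length ys}" "set ys"] assms(3)
    by (simp add: atLeast0LessThan)
  define f where "f = inv_into {0..<length xs} ((!) xs) \<circ> (!) ys"
  have "bij_betw f {0..<length ys} {0..<length xs}"
    unfolding f_def using by' bij_betw_inv_into[OF bx] by (rule bij_betw_trans)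
  moreover have "xs ! f i = ys ! i" if "i < length ys" for i
  proof -
    have "ys ! i \<in> (!) xs ` {0..<length xs}"
      using that assms(3) bx by (metis bij_betw_imp_surj_on nth_mem)
    thus ?thesis unfolding f_def comp_def by (rule f_inv_into_f)
  qed
  ultimately show thesis by (rule that)
qed

lemma reindex_mat_inverse:
  fixes Z W :: "real mat"
  assumes W: "W \<in> carrier_mat n n" and Z: "Z \<in> carrier_mat n n" and ZW: "Z * W = 1\<^sub>m n"
    and f: "bij_betw f {0..<n} {0..<n}"
  shows "mat n n (\<lambda>(i, j). Z $$ (f i, f j)) * mat n n (\<lambda>(i, j). W $$ (f i, f j)) = 1\<^sub>m n"
proof (rule eq_matI)
  fix i j assume "i < dim_row (1\<^sub>m n :: real mat)" "j < dim_col (1\<^sub>m n :: real mat)"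
  hence ij: "i < n" "j < n" by auto
  have fi: "f m < n" if "m < n" for m using f that by (auto dest: bij_betwE)
  have inj: "f i = f j \<longleftrightarrow> i = j"
    using inj_on_eq_iff[OF bij_betw_imp_inj_on[OF f]] ij by simp
  have "(mat n n (\<lambda>(i, j). Z $$ (f i, f j)) * mat n n (\<lambda>(i, j). W $$ (f i, f j))) $$ (i, j)
        = (\<Sum>l\<in>{0..<n}. Z $$ (f i, f l) * W $$ (f l, f j))"
    using ij by (simp add: scalar_prod_def)
  also have "\<dots> = (\<Sum>l\<in>{0..<n}. Z $$ (f i, l) * W $$ (l, f j))"
    using f by (rule sum.reindex_bij_betw)
  also have "\<dots> = (Z * W) $$ (f i, f j)"
    using ij fi Z W by (simp add: scalar_prod_def)
  also have "\<dots> = (1\<^sub>m n :: real mat) $$ (i, j)"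
    unfolding ZW using ij fi inj by simp
  finally show "(mat n n (\<lambda>(i, j). Z $$ (f i, f j)) * mat n n (\<lambda>(i, j). W $$ (f i, f j))) $$ (i, j)
        = (1\<^sub>m n :: real mat) $$ (i, j)" .
qed auto

lemma mat_inverse_eqI:
  fixes A B :: "real mat"
  assumes A: "A \<in> carrier_mat n n" and B: "B \<in> carrier_mat n n"
    and AB: "A * B = 1\<^sub>m n" and BA: "B * A = 1\<^sub>m n"
  shows "mat_inverse A = Some B"
proof (cases "mat_inverse A")
  case None
  have "A \<in> Units (ring_mat TYPE(real) n n)"
    using A B AB BA unfolding Units_def ring_mat_def by auto
  with mat_inverse(1)[OF A None, of n] show ?thesis by simp
next
  case (Some C)
  from mat_inverse(2)[OF A Some] have AC: "A * C = 1\<^sub>m n" and C: "C \<in> carrier_mat n n" by auto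
  have "C = (B * A) * C" using C BA by simp
  also have "\<dots> = B * (A * C)" using A B C by (intro assoc_mult_mat)
  also have "\<dots> = B" using AC B by simp
  finally show ?thesis using Some by simp
qed

lemma similarity_mat_carrier: "similarity_mat \<beta> xs \<in> carrier_mat (length xs) (length xs)"
  by (simp add: similarity_mat_def)

lemma similarity_mat_inverse:
  assumes "invertible_mat (similarity_mat \<beta> xs)"
  obtains W where "W \<in> carrier_mat (length xs) (length xs)"
    "similarity_mat \<beta> xs * W = 1\<^sub>m (length xs)" "W * similarity_mat \<beta> xs = 1\<^sub>m (length xs)"
proof -
  let ?Z = "similarity_mat \<beta> xs" and ?n = "length xs"
  obtain W where W: "?Z * W = 1\<^sub>m (dim_row ?Z)" "W * ?Z = 1\<^sub>m (dim_row W)"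
    using assms unfolding invertible_mat_def inverts_mat_def by auto
  have Z: "dim_row ?Z = ?n" "dim_col ?Z = ?n" by (auto simp: similarity_mat_def)
  have c: "dim_col W = ?n" using arg_cong[OF W(1), of dim_col] Z by simp
  have r: "dim_row W = ?n" using arg_cong[OF W(2), of dim_col] Z by simp
  show thesis using W Z c r by (intro that[of W]) auto
qed

lemma diversity_list_cong:
  assumes "distinct xs" "distinct ys" "set xs = set ys"
    and inv: "invertible_mat (similarity_mat \<beta> xs)"
  shows "invertible_mat (similarity_mat \<beta> ys)" "diversity_list \<beta> ys = diversity_list \<beta> xs"
proof -
  let ?n = "length xs"
  have len: "length ys = ?n" using assms(1-3) by (metis distinct_card)
  obtain f where f: "bij_betw f {0..<?n} {0..<?n}"
    and xy: "\<And>i. i < ?n \<Longrightarrow> xs ! f i = ys ! i"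
    using distinct_lists_reindex[OF assms(1-3)] len by metis
  have fi: "f i < ?n" if "i < ?n" for i using f that by (auto dest: bij_betwE)
  let ?Z = "similarity_mat \<beta> xs" and ?Y = "similarity_mat \<beta> ys"
  have Z: "?Z \<in> carrier_mat ?n ?n" by (rule similarity_mat_carrier)
  have Y: "?Y \<in> carrier_mat ?n ?n" using similarity_mat_carrier[of \<beta> ys] len by simp
  obtain W where W: "W \<in> carrier_mat ?n ?n" "?Z * W = 1\<^sub>m ?n" "W * ?Z = 1\<^sub>m ?n"
    using similarity_mat_inverse[OF inv] .
  define V where "V = mat ?n ?n (\<lambda>(i, j). W $$ (f i, f j))"
  have V: "V \<in> carrier_mat ?n ?n" unfolding V_def by simp
  have Yeq: "?Y = mat ?n ?n (\<lambda>(i, j). ?Z $$ (f i, f j))"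
    by (rule eq_matI) (auto simp: similarity_mat_def len fi xy)
  have YV: "?Y * V = 1\<^sub>m ?n"
    unfolding Yeq V_def by (rule reindex_mat_inverse[OF W(1) Z W(2) f])
  have VY: "V * ?Y = 1\<^sub>m ?n"
    unfolding Yeq V_def by (rule reindex_mat_inverse[OF Z W(1) W(3) f])
  show "invertible_mat ?Y"
    using Y V YV VY unfolding invertible_mat_def inverts_mat_def by auto
  have sum_form: "all_ones ?n \<bullet> (A *\<^sub>v all_ones ?n) = (\<Sum>i\<in>{0..<?n}. \<Sum>j\<in>{0..<?n}. A $$ (i, j))"
    if "A \<in> carrier_mat ?n ?n" for A
    using that by (simp add: all_ones_def scalar_prod_def)
  have "diversity_list \<beta> ys = (\<Sum>i\<in>{0..<?n}. \<Sum>j\<in>{0..<?n}. V $$ (i, j))"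
    unfolding diversity_list_def len mat_inverse_eqI[OF Y V YV VY]
    by (simp add: sum_form[OF V])
  also have "\<dots> = (\<Sum>i\<in>{0..<?n}. \<Sum>j\<in>{0..<?n}. W $$ (f i, f j))"
    unfolding V_def by simp
  also have "\<dots> = (\<Sum>i\<in>{0..<?n}. \<Sum>j\<in>{0..<?n}. W $$ (f i, j))"
    by (rule sum.cong[OF refl], rule sum.reindex_bij_betw[OF f])
  also have "\<dots> = (\<Sum>i\<in>{0..<?n}. \<Sum>j\<in>{0..<?n}. W $$ (i, j))"
    by (rule sum.reindex_bij_betw[OF f])
  also have "\<dots> = diversity_list \<beta> xs"
    unfolding diversity_list_def mat_inverse_eqI[OF Z W]
    by (simp add: sum_form[OF W(1)])
  finally show "diversity_list \<beta> ys = diversity_list \<beta> xs" .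
qed

lemma invertible_similarity_mat_cong:
  assumes "distinct xs" "set xs = S"
  shows "invertible_mat (similarity_mat \<beta> (enum_set S)) \<longleftrightarrow> invertible_mat (similarity_mat \<beta> xs)"
proof -
  have "finite S" using assms(2) by auto
  note e = enum_set[OF this]
  show ?thesis
    using diversity_list_cong(1)[of xs "enum_set S" \<beta>] diversity_list_cong(1)[of "enum_set S" xs \<beta>]
      assms e by auto
qed

lemma solow_polasky_eq_diversity_list:
  assumes "distinct xs" "set xs = S" "invertible_mat (similarity_mat \<beta> xs)"
  shows "solow_polasky \<beta> S = diversity_list \<beta> xs"
proof -
  have "finite S" using assms(2) by auto
  note e = enum_set[OF this]
  show ?thesis
    unfolding solow_polasky_def
    using diversity_list_cong(2)[of xs "enum_set S" \<beta>] assms e by auto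
qed

end

theory Submission
  imports Defs "Jordan_Normal_Form.Determinant"
begin

text \<open>Adding a point \<open>x\<close> to the left of a finite set \<open>S\<close> with least element \<open>y\<close> affects the equations
  \<open>Z w = \<one>\<close> only through the factor \<open>a = exp (- \<beta> (y - x))\<close>: the weight at \<open>x\<close> becomes
  \<open>1 / (1 + a)\<close>, the weight at \<open>y\<close> decreases by \<open>a / (1 + a)\<close>, and all others are unchanged. Hence each
  gap \<open>g\<close> contributes \<open>(1 - exp (- \<beta> g)) / (1 + exp (- \<beta> g)) = tanh (\<beta> g / 2)\<close> to the diversity. The
  gaps sum to at most \<open>1\<close>, and comparison with the tangent of the strictly concave \<open>tanh\<close> at
  \<open>\<beta> / (2 (k - 1))\<close> yields both the bound and its equality case.\<close>

section \<open>Similarity matrices as kernels on the points\<close>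

text \<open>Lets vectors be functions on the points, so that later inductions run over sets and not
  over matrix indices.\<close>

lemma similarity_mat_mult_vec:
  assumes "distinct xs" "i < length xs"
  shows "(similarity_mat \<beta> xs *\<^sub>v vec (length xs) (\<lambda>j. v (xs ! j))) $ i
    = (\<Sum>y\<in>set xs. exp (- \<beta> * dist (xs ! i) y) * v y)"
proof -
  have "bij_betw ((!) xs) {0..<length xs} (set xs)"
    using bij_betw_nth[OF assms(1), of "{..<length xs}" "set xs"] by (simp add: atLeast0LessThan)
  from sum.reindex_bij_betw[OF this, of "\<lambda>y. exp (- \<beta> * dist (xs ! i) y) * v y"] assms(2)
  show ?thesis by (simp add: similarity_mat_def scalar_prod_def)
qed

lemma invertible_similarity_matI:
  fixes xs :: "'a::metric_space list"
  assumes "distinct xs"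
    and kernel: "\<And>v. (\<And>x. x \<in> set xs \<Longrightarrow> (\<Sum>y\<in>set xs. exp (- \<beta> * dist x y) * v y) = 0) \<Longrightarrow>
      (\<And>x. x \<in> set xs \<Longrightarrow> v x = (0::real))"
  shows "invertible_mat (similarity_mat \<beta> xs)"
proof -
  let ?n = "length xs" and ?Z = "similarity_mat \<beta> xs"
  have Z: "?Z \<in> carrier_mat ?n ?n" by (rule similarity_mat_carrier)
  have "det ?Z \<noteq> 0"
  proof
    assume "det ?Z = 0"
    then obtain u where u: "u \<in> carrier_vec ?n" "u \<noteq> 0\<^sub>v ?n" "?Z *\<^sub>v u = 0\<^sub>v ?n"
      using det_0_iff_vec_prod_zero[OF Z] by blast
    \<comment> \<open>Transports the kernel vector \<open>u\<close> to a function on points; the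
      index of a point is unique since \<open>xs\<close> is distinct.\<close>
    define v where "v x = u $ (THE j. j < ?n \<and> xs ! j = x)" for x
    have v: "v (xs ! j) = u $ j" if "j < ?n" for j
    proof -
      have "(THE i. i < ?n \<and> xs ! i = xs ! j) = j"
        using that assms(1) by (auto simp: nth_eq_iff_index_eq)
      thus ?thesis by (simp add: v_def)
    qed
    have uv: "u = vec ?n (\<lambda>j. v (xs ! j))" using u(1) by (intro eq_vecI) (simp_all add: v)
    have "(\<Sum>y\<in>set xs. exp (- \<beta> * dist x y) * v y) = 0" if x: "x \<in> set xs" for x
    proof -
      obtain i where i: "i < ?n" "x = xs ! i" using x by (metis in_set_conv_nth)
      have "?Z *\<^sub>v vec ?n (\<lambda>j. v (xs ! j)) = 0\<^sub>v ?n"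
        by (subst uv[symmetric]) (rule u(3))
      from similarity_mat_mult_vec[OF assms(1) i(1), of \<beta> v, unfolded this]
      show ?thesis using i by simp
    qed
    hence "v x = 0" if "x \<in> set xs" for x using kernel that by blast
    hence "u = 0\<^sub>v ?n" using uv by (auto simp: v)
    with u(2) show False by contradiction
  qed
  from det_non_zero_imp_unit[OF Z this, of ?n]
  show ?thesis using Z
    by (auto simp: Units_def ring_mat_def invertible_mat_def inverts_mat_def)
qed

text \<open>Applying the inverse to \<open>Z w = 1\<close> identifies \<open>w\<close> with the
  vector that the diversity sums, so exhibiting one solution replaces computing the inverse.\<close>

lemma diversity_list_eq_sum_weights:
  fixes xs :: "'a::metric_space list"
  assumes "distinct xs" and inv: "invertible_mat (similarity_mat \<beta> xs)"
    and w: "\<And>x. x \<in> set xs \<Longrightarrow> (\<Sum>y\<in>set xs. exp (- \<beta> * dist x y) * w y) = 1"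
  shows "diversity_list \<beta> xs = sum w (set xs)"
proof -
  let ?n = "length xs" and ?Z = "similarity_mat \<beta> xs" and ?w = "vec (length xs) (\<lambda>j. w (xs ! j))"
  have Z: "?Z \<in> carrier_mat ?n ?n" by (rule similarity_mat_carrier)
  obtain B where B: "B \<in> carrier_mat ?n ?n" "?Z * B = 1\<^sub>m ?n" "B * ?Z = 1\<^sub>m ?n"
    using similarity_mat_inverse[OF inv] .
  have "?Z *\<^sub>v ?w = all_ones ?n"
  proof (rule eq_vecI)
    fix i assume "i < dim_vec (all_ones ?n)"
    hence "i < ?n" by (simp add: all_ones_def)
    thus "(?Z *\<^sub>v ?w) $ i = all_ones ?n $ i"
      using similarity_mat_mult_vec[OF assms(1), of i \<beta> w] w by (simp add: all_ones_def)
  qed (use Z in \<open>simp add: all_ones_def\<close>)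
  hence "B *\<^sub>v all_ones ?n = (B * ?Z) *\<^sub>v ?w"
    using assoc_mult_mat_vec[OF B(1) Z, of ?w] by simp
  hence "B *\<^sub>v all_ones ?n = ?w" using B(3) by simp
  moreover have "mat_inverse ?Z = Some B" by (rule mat_inverse_eqI[OF Z B])
  ultimately have "diversity_list \<beta> xs = (\<Sum>j\<in>{0..<?n}. w (xs ! j))"
    by (simp add: diversity_list_def all_ones_def scalar_prod_def)
  also have "\<dots> = sum w (set xs)"
    using bij_betw_nth[OF assms(1), of "{..<?n}" "set xs"]
    by (intro sum.reindex_bij_betw) (simp add: atLeast0LessThan)
  finally show ?thesis .
qed

section \<open>Finite subsets of the line\<close>

text \<open>Distances along a line add up, so the kernel is multiplicative. Hence, on points to the
  right of \<open>y\<close>, the row of \<open>x\<close> is a multiple of the row of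
  \<open>y\<close>.\<close>

lemma exp_dist_trans:
  fixes x y z :: real
  assumes "x \<le> y" "y \<le> z"
  shows "exp (- \<beta> * dist x z) = exp (- \<beta> * (y - x)) * exp (- \<beta> * dist y z)"
  using assms by (simp add: dist_real_def exp_add[symmetric] algebra_simps)

text \<open>Induction by adding a new least point \<open>x\<close>. With \<open>y\<close> the old
  minimum, the equations at \<open>x\<close> and \<open>y\<close> form a 2 by 2 system in
  \<open>v x\<close> and \<open>R\<close> with determinant \<open>1 - a * a\<close>, which is
  nonzero because \<open>a < 1\<close>. So \<open>v x = 0\<close>, and the equations for
  \<open>S\<close> remain.\<close>

lemma exp_kernel_trivial:
  fixes S :: "real set"
  assumes "\<beta> > 0" "finite S"
    and "\<And>x. x \<in> S \<Longrightarrow> (\<Sum>y\<in>S. exp (- \<beta> * dist x y) * v y) = 0"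
  shows "\<forall>x\<in>S. v x = 0"
  using assms(2,3)
proof (induction S rule: finite_linorder_min_induct)
  case (insert x S)
  have x: "x \<notin> S" using insert.hyps by blast
  have "v x = 0"
  proof (cases "S = {}")
    case True
    with insert.prems[of x] show ?thesis by simp
  next
    case False
    define y where "y = Min S"
    have y: "y \<in> S" "\<And>z. z \<in> S \<Longrightarrow> y \<le> z" using False insert.hyps by (auto simp: y_def)
    have xy: "x < y" using y insert.hyps by blast
    define a R where "a = exp (- \<beta> * (y - x))" and "R = (\<Sum>z\<in>S. exp (- \<beta> * dist y z) * v z)"
    have a: "0 < a" "a < 1" using xy assms(1) by (auto simp: a_def)
    have "(\<Sum>z\<in>S. exp (- \<beta> * dist x z) * v z) = a * R"
      unfolding R_def sum_distrib_left a_def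
      using xy y by (intro sum.cong refl) (simp only: exp_dist_trans[of x y] less_imp_le mult.assoc)
    hence 1: "v x + a * R = 0" using insert.prems[of x] x insert.hyps by simp
    have "exp (- \<beta> * dist y x) = a" using xy by (simp add: a_def dist_real_def)
    hence 2: "a * v x + R = 0" using insert.prems[of y] x insert.hyps y(1) by (simp add: R_def)
    have "R = - a * v x" using 2 by simp
    hence "(1 - a * a) * v x = 0" using 1 by (simp add: algebra_simps)
    moreover have "a * a < 1" using a mult_strict_mono[of a 1 a 1] by simp
    ultimately show ?thesis by simp
  qed
  moreover have "\<forall>z\<in>S. v z = 0"
  proof (rule insert.IH)
    fix z assume "z \<in> S"
    with insert.prems[of z] \<open>v x = 0\<close> x insert.hyps
    show "(\<Sum>y\<in>S. exp (- \<beta> * dist z y) * v y) = 0" by simp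
  qed
  ultimately show ?case by simp
qed simp

lemma invertible_similarity_mat_real:
  fixes xs :: "real list"
  assumes "\<beta> > 0" "distinct xs"
  shows "invertible_mat (similarity_mat \<beta> xs)"
  using assms(2)
proof (rule invertible_similarity_matI)
  fix v :: "real \<Rightarrow> real" and x
  assume "\<And>x. x \<in> set xs \<Longrightarrow> (\<Sum>y\<in>set xs. exp (- \<beta> * dist x y) * v y) = 0" "x \<in> set xs"
  thus "v x = 0" using exp_kernel_trivial[OF assms(1), of "set xs" v] by blast
qed

lemma tanh_half: "tanh (t / 2) = (1 - exp (- t)) / (1 + exp (- t))" for t :: real
  by (simp add: tanh_real_altdef)

lemma weights_exist:
  fixes xs :: "real list"
  assumes "xs \<noteq> []" "sorted_wrt (<) xs"
  shows "\<exists>w. (\<forall>x\<in>set xs. (\<Sum>y\<in>set xs. exp (- \<beta> * dist x y) * w y) = 1) \<and>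
    sum w (set xs) = 1 + (\<Sum>i<length xs - 1. tanh (\<beta> * (xs ! Suc i - xs ! i) / 2))"
  using assms
proof (induction xs rule: induct_list012)
  case (2 x)
  show ?case by (rule exI[of _ "\<lambda>_. 1"]) simp
next
  case (3 x y zs)
  let ?S = "set (y # zs)"
  obtain w where w: "\<And>z. z \<in> ?S \<Longrightarrow> (\<Sum>u\<in>?S. exp (- \<beta> * dist z u) * w u) = 1"
    and sw: "sum w ?S = 1 + (\<Sum>i<length zs. tanh (\<beta> * ((y # zs) ! Suc i - (y # zs) ! i) / 2))"
    using "3.IH"(2) "3.prems" by fastforce
  have xy: "x < y" and le: "\<And>z. z \<in> ?S \<Longrightarrow> y \<le> z" and x: "x \<notin> ?S" "y \<in> ?S"
    using "3.prems" by auto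
  define a where "a = exp (- \<beta> * (y - x))"
  have a: "1 + a > 0" by (simp add: a_def add_pos_pos)
  \<comment> \<open>If \<open>x\<close> gets weight \<open>p\<close> and the weight at
    \<open>y\<close> changes by \<open>c\<close>, row \<open>y\<close> demands
    \<open>a * p + c = 0\<close> and row \<open>x\<close> demands \<open>p + a + a * c = 1\<close>;
    the solution is \<open>p = 1 / (1 + a)\<close>, \<open>c = - a / (1 + a)\<close>.\<close>
  define w' where "w' u = (if u = x then 1 / (1 + a) else if u = y then w y - a / (1 + a) else w u)"
    for u
  have sum': "(\<Sum>u\<in>?S. f u * w' u) = (\<Sum>u\<in>?S. f u * w u) - f y * (a / (1 + a))" for f
  proof -
    have "(\<Sum>u\<in>?S. f u * w' u) = (\<Sum>u\<in>?S. f u * w u - (if u = y then f y * (a / (1 + a)) else 0))"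
      using x by (intro sum.cong refl) (auto simp: w'_def right_diff_distrib)
    thus ?thesis using x(2) by (simp only: sum_subtractf) simp
  qed
  have ax: "exp (- \<beta> * dist x z) = a * exp (- \<beta> * dist y z)" if "z \<in> ?S" for z
    unfolding a_def using xy le[OF that] by (intro exp_dist_trans) auto
  have ins: "(\<Sum>u\<in>set (x # y # zs). f u) = f x + (\<Sum>u\<in>?S. f u)" for f :: "real \<Rightarrow> real"
    unfolding list.set(2)[of x] by (rule sum.insert[OF finite_set x(1)])
  have "(\<Sum>u\<in>set (x # y # zs). exp (- \<beta> * dist z u) * w' u) = 1" if "z \<in> set (x # y # zs)" for z
  proof (cases "z = x")
    case True
    have "(\<Sum>u\<in>?S. exp (- \<beta> * dist x u) * w u) = a * (\<Sum>u\<in>?S. exp (- \<beta> * dist y u) * w u)"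
      unfolding sum_distrib_left by (intro sum.cong refl) (simp only: ax mult.assoc)
    hence "(\<Sum>u\<in>?S. exp (- \<beta> * dist x u) * w u) = a" using w[OF x(2)] by simp
    moreover have "exp (- \<beta> * dist x y) = a" using ax[OF x(2)] by simp
    ultimately have "(\<Sum>u\<in>set (x # y # zs). exp (- \<beta> * dist x u) * w' u)
        = 1 / (1 + a) + (a - a * (a / (1 + a)))"
      unfolding ins sum' by (simp add: w'_def)
    also have "\<dots> = 1" using a by (simp add: field_simps)
    finally show ?thesis using True by simp
  next
    case False
    hence z: "z \<in> ?S" using that by simp
    have "(\<Sum>u\<in>set (x # y # zs). exp (- \<beta> * dist z u) * w' u)
        = exp (- \<beta> * dist z x) / (1 + a) + (1 - exp (- \<beta> * dist z y) * (a / (1 + a)))"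
      unfolding ins sum' w[OF z] by (simp add: w'_def)
    \<comment> \<open>The contribution of \<open>x\<close> to row \<open>z\<close> carries the
      factor \<open>a\<close> and cancels the correction at \<open>y\<close>.\<close>
    thus ?thesis using ax[OF z] by (simp add: dist_commute)
  qed
  moreover have "sum w' (set (x # y # zs)) = 1 / (1 + a) + (sum w ?S - a / (1 + a))"
    unfolding ins using sum'[of "\<lambda>_. 1"] by (simp add: w'_def)
  hence "sum w' (set (x # y # zs)) = sum w ?S + tanh (\<beta> * (y - x) / 2)"
    by (simp add: tanh_half a_def diff_divide_distrib)
  \<comment> \<open>The new gap has index 0, so the sum is split at its front.\<close>
  ultimately show ?case
    using sw by (intro exI[of _ w']) (simp add: sum.lessThan_Suc_shift del: sum.lessThan_Suc)
qed simp

lemma solow_polasky_real: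
  fixes xs :: "real list"
  assumes "\<beta> > 0" "xs \<noteq> []" "sorted_wrt (<) xs"
  shows "solow_polasky \<beta> (set xs)
    = 1 + (\<Sum>i<length xs - 1. tanh (\<beta> * (xs ! Suc i - xs ! i) / 2))"
proof -
  have d: "distinct xs" using assms(3) strict_sorted_iff by blast
  have inv: "invertible_mat (similarity_mat \<beta> xs)"
    by (rule invertible_similarity_mat_real[OF assms(1) d])
  show ?thesis
    using weights_exist[OF assms(2,3), of \<beta>] diversity_list_eq_sum_weights[OF d inv]
      solow_polasky_eq_diversity_list[OF d refl inv] by fastforce
qed

section \<open>Optimization of the gaps\<close>

text \<open>By the mean value theorem the secant slope is the derivative
  \<open>1 - (tanh z)\<^sup>2\<close> at some \<open>z\<close> strictly between \<open>s\<close> and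
  \<open>t\<close>; this derivative is strictly decreasing on the nonnegative reals.\<close>

lemma tanh_less_tangent:
  fixes s t :: real
  assumes "s \<ge> 0" "t \<ge> 0" "s \<noteq> t"
  shows "tanh t < tanh s + (1 - (tanh s)\<^sup>2) * (t - s)"
proof -
  have D: "(tanh has_real_derivative 1 - (tanh x)\<^sup>2) (at x)" for x :: real
    by (auto intro!: derivative_eq_intros)
  show ?thesis
  proof (cases "s < t")
    case True
    then obtain z where z: "s < z" "z < t" "tanh t - tanh s = (t - s) * (1 - (tanh z)\<^sup>2)"
      using MVT2[of s t tanh "\<lambda>x. 1 - (tanh x)\<^sup>2"] D by blast
    have "(tanh s)\<^sup>2 < (tanh z)\<^sup>2" using z assms by (intro power_strict_mono) auto
    hence "(t - s) * (1 - (tanh z)\<^sup>2) < (t - s) * (1 - (tanh s)\<^sup>2)" using True by simp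
    thus ?thesis using z(3) by (simp add: mult.commute)
  next
    case False
    hence ts: "t < s" using assms(3) by simp
    then obtain z where z: "t < z" "z < s" "tanh s - tanh t = (s - t) * (1 - (tanh z)\<^sup>2)"
      using MVT2[of t s tanh "\<lambda>x. 1 - (tanh x)\<^sup>2"] D by blast
    have "(tanh z)\<^sup>2 < (tanh s)\<^sup>2" using z assms by (intro power_strict_mono) auto
    hence "(s - t) * (1 - (tanh s)\<^sup>2) < (s - t) * (1 - (tanh z)\<^sup>2)" using ts by simp
    thus ?thesis using z(3) by (simp add: algebra_simps)
  qed
qed

text \<open>The sum of the tangent bounds depends on \<open>g\<close> only through its total, and
  the slope is positive, so a total of at most 1 suffices. This covers sets that miss an endpoint of
  the interval.\<close>

lemma sum_tanh_le:
  fixes g :: "nat \<Rightarrow> real"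
  assumes "\<beta> > 0" "m > 0" and g: "\<And>i. i < m \<Longrightarrow> g i \<ge> 0" "(\<Sum>i<m. g i) \<le> 1"
  shows "(\<Sum>i<m. tanh (\<beta> * g i / 2)) \<le> real m * tanh (\<beta> / (2 * real m))"
    and "(\<Sum>i<m. tanh (\<beta> * g i / 2)) = real m * tanh (\<beta> / (2 * real m)) \<Longrightarrow> \<forall>i<m. g i = 1 / real m"
proof -
  define s where "s = \<beta> / (2 * real m)"
  have s: "s > 0" using assms by (simp add: s_def)
  \<comment> \<open>The tangent at \<open>s\<close>, the argument belonging to the equal gap
    \<open>1 / real m\<close>; it touches \<open>tanh\<close> only there.\<close>
  define f where "f i = tanh s + (1 - (tanh s)\<^sup>2) * (\<beta> * g i / 2 - s)" for i
  have less: "tanh (\<beta> * g i / 2) < f i" if "i < m" "g i \<noteq> 1 / real m" for i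
    unfolding f_def using that assms s
    by (intro tanh_less_tangent) (auto simp: s_def field_simps)
  have le: "tanh (\<beta> * g i / 2) \<le> f i" if "i < m" for i
  proof (cases "g i = 1 / real m")
    case True
    thus ?thesis by (simp add: f_def s_def mult.commute)
  qed (use less[OF that] in simp)
  have "(tanh s)\<^sup>2 < 1"
    using tanh_real_lt_1[of s] s by (simp add: power_less_one_iff abs_square_less_1)
  moreover have "\<beta> * (\<Sum>i<m. g i) / 2 - real m * s \<le> 0" using assms by (simp add: s_def)
  ultimately have "(1 - (tanh s)\<^sup>2) * (\<beta> * (\<Sum>i<m. g i) / 2 - real m * s) \<le> 0"
    by (intro mult_nonneg_nonpos) auto
  moreover have "(\<Sum>i<m. f i) = real m * tanh s + (1 - (tanh s)\<^sup>2) * (\<beta> * (\<Sum>i<m. g i) / 2 - real m * s)"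
    by (simp add: f_def sum.distrib sum_subtractf sum_distrib_left[symmetric]
        sum_divide_distrib[symmetric])
  ultimately have f: "(\<Sum>i<m. f i) \<le> real m * tanh s" by simp
  have "(\<Sum>i<m. tanh (\<beta> * g i / 2)) \<le> (\<Sum>i<m. f i)" using le by (intro sum_mono) auto
  with f show "(\<Sum>i<m. tanh (\<beta> * g i / 2)) \<le> real m * tanh (\<beta> / (2 * real m))" by (simp add: s_def)
  assume eq: "(\<Sum>i<m. tanh (\<beta> * g i / 2)) = real m * tanh (\<beta> / (2 * real m))"
  show "\<forall>i<m. g i = 1 / real m"
  proof (rule ccontr)
    assume "\<not> (\<forall>i<m. g i = 1 / real m)"
    \<comment> \<open>One deviating gap makes one summand strictly smaller, and the others are
      bounded weakly.\<close>
    hence "(\<Sum>i<m. tanh (\<beta> * g i / 2)) < (\<Sum>i<m. f i)"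
      using le less by (intro sum_strict_mono_ex1) auto
    with f eq show False by (simp add: s_def)
  qed
qed

lemma solow_polasky_unit_interval:
  fixes S :: "real set"
  assumes "\<beta> > 0" "k \<ge> 2" "S \<subseteq> {0..1}" "card S = k"
  shows "solow_polasky \<beta> S \<le> 1 + (real k - 1) * tanh (\<beta> / (2 * (real k - 1)))"
    and "solow_polasky \<beta> S = 1 + (real k - 1) * tanh (\<beta> / (2 * (real k - 1))) \<Longrightarrow>
      S = uniform_points k"
proof -
  \<comment> \<open>Infinite sets have \<open>card\<close> 0, which \<open>k \<ge> 2\<close>
    excludes.\<close>
  have fin: "finite S" using assms(2,4) by (intro card_ge_0_finite) simp
  define xs where "xs = sorted_list_of_set S"
  have xs: "set xs = S" "length xs = k" "sorted_wrt (<) xs" "xs \<noteq> []"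
    using fin assms(2,4) by (auto simp: xs_def)
  define m g where "m = k - 1" and "g i = xs ! Suc i - xs ! i" for i
  have m: "m > 0" "k = Suc m" "real k - 1 = real m" using assms(2) by (auto simp: m_def)
  have S01: "xs ! i \<in> {0..1}" if "i \<le> m" for i
    using that xs(1,2) m(2) assms(3) nth_mem[of i xs] by auto
  have val: "solow_polasky \<beta> S = 1 + (\<Sum>i<m. tanh (\<beta> * g i / 2))"
    using solow_polasky_real[OF assms(1) xs(4,3)] xs(1,2) by (simp add: m_def g_def)
  have g0: "g i \<ge> 0" if "i < m" for i
    using sorted_wrt_nth_less[OF xs(3), of i "Suc i"] that xs(2) m(2) by (simp add: g_def)
  have tele: "(\<Sum>i<j. g i) = xs ! j - xs ! 0" for j
    unfolding g_def by (rule sum_lessThan_telescope)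
  have g1: "(\<Sum>i<m. g i) \<le> 1" using S01[of 0] S01[of m] by (simp add: tele)
  show "solow_polasky \<beta> S \<le> 1 + (real k - 1) * tanh (\<beta> / (2 * (real k - 1)))"
    unfolding val m(3) using sum_tanh_le(1)[OF assms(1) m(1) g0 g1] by simp
  assume "solow_polasky \<beta> S = 1 + (real k - 1) * tanh (\<beta> / (2 * (real k - 1)))"
  hence eq: "\<forall>i<m. g i = 1 / m"
    unfolding val m(3) using sum_tanh_le(2)[OF assms(1) m(1) g0 g1] by simp
  have step: "xs ! j = xs ! 0 + j / m" if "j \<le> m" for j
    using tele[of j] eq that by simp
  \<comment> \<open>Equal gaps \<open>1 / m\<close> span length 1, so the first point has no room to
    move inside the unit interval.\<close>
  have "xs ! 0 = 0" using step[of m] S01[of 0] S01[of m] m(1) by simp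
  with step have nth: "xs ! j = j / m" if "j \<le> m" for j using that by simp
  have "S = (!) xs ` {..<k}" using nth_image[of k xs] xs(1,2) by (simp add: atLeast0LessThan)
  also have "\<dots> = uniform_points k"
    unfolding uniform_points_def using m(2,3) nth by (intro image_cong) auto
  finally show "S = uniform_points k" .
qed

lemma uniform_points:
  assumes "\<beta> > 0" "k \<ge> 2"
  shows "uniform_points k \<subseteq> {0..1}" "card (uniform_points k) = k"
    and "solow_polasky \<beta> (uniform_points k)
      = 1 + (real k - 1) * tanh (\<beta> / (2 * (real k - 1)))"
proof -
  define xs where "xs = map (\<lambda>i. real i / (real k - 1)) [0..<k]"
  have xs: "set xs = uniform_points k" "length xs = k" "xs \<noteq> []"
    using assms(2) by (auto simp: xs_def uniform_points_def)
  have sorted: "sorted_wrt (<) xs"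
    using assms(2) by (simp add: xs_def sorted_wrt_iff_nth_less divide_strict_right_mono)
  show "uniform_points k \<subseteq> {0..1}" using assms(2) by (auto simp: uniform_points_def)
  show "card (uniform_points k) = k"
    using sorted xs distinct_card[of xs] strict_sorted_iff by metis
  have nth: "xs ! i = real i / (real k - 1)" if "i < k" for i
    using that unfolding xs_def by simp
  have gap: "xs ! Suc i - xs ! i = 1 / (real k - 1)" if "i < k - 1" for i
    using that nth[of i] nth[of "Suc i"] by (simp add: diff_divide_distrib[symmetric])
  have "(\<Sum>i<k - 1. tanh (\<beta> * (xs ! Suc i - xs ! i) / 2))
      = (\<Sum>i<k - 1. tanh (\<beta> / (2 * (real k - 1))))"
    by (intro sum.cong refl) (simp add: gap mult.commute)
  thus "solow_polasky \<beta> (uniform_points k)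
      = 1 + (real k - 1) * tanh (\<beta> / (2 * (real k - 1)))"
    using solow_polasky_real[OF assms(1) xs(3) sorted] assms(2)
    by (simp add: xs(1,2))
qed

theorem theorem1:
  fixes k :: nat and \<beta> :: real
  assumes "k \<ge> 2" and "\<beta> > 0"
  shows "(\<forall>S::real set. S \<subseteq> {0..1} \<and> card S = k \<longrightarrow>
            invertible_mat (similarity_mat \<beta> (enum_set S)))
       \<and> uniform_points k \<subseteq> {0..1} \<and> card (uniform_points k) = k
       \<and> (\<forall>S::real set. S \<subseteq> {0..1} \<and> card S = k \<longrightarrow>
            solow_polasky \<beta> S \<le> solow_polasky \<beta> (uniform_points k))
       \<and> solow_polasky \<beta> (uniform_points k)
           = 1 + (real k - 1) * tanh (\<beta> / (2 * (real k - 1)))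
       \<and> (\<forall>S::real set. S \<subseteq> {0..1} \<and> card S = k \<and>
            solow_polasky \<beta> S = solow_polasky \<beta> (uniform_points k) \<longrightarrow> S = uniform_points k)"
proof -
  have "invertible_mat (similarity_mat \<beta> (enum_set S))" if "card S = k" for S :: "real set"
  proof -
    have "finite S" using that assms(1) by (intro card_ge_0_finite) simp
    thus ?thesis using invertible_similarity_mat_real assms(2) enum_set(1) by blast
  qed
  moreover note U = uniform_points[OF assms(2,1)]
  \<comment> \<open>Folding turns the closed form into the diversity of
    \<open>uniform_points k\<close>, so that the bound and its equality case compare with the
    maximizer itself.\<close>
  moreover note solow_polasky_unit_interval[OF assms(2,1), folded U(3)]
  ultimately show ?thesis by (intro conjI allI impI) blast+
qed

end
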